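(* For integers $n\ge k\ge 0$, $$q^{\frac{3k(k-1)}{2}}\,\frac{\begin{bmatrix} n\\ k\end{bmatrix}_q\begin{bmatrix} n+1\\ k\end{bmatrix}_q\begin{bmatrix} n+2\\ k\end{bmatrix}_q}{\begin{bmatrix} k+1\\ k\end{bmatrix}_q\begin{bmatrix} k+2\\ k\end{bmatrix}_q}=s_{(3^k)}(1,q,\ldots,q^{n-1}).$$ That is, $B_q(n,k)=\mathrm{ps}_n\left(s_{(3^k)}\right)$, where $B_q(n,k)$ denotes the left-hand side (the $q$-refined Baxter number) and $\mathrm{ps}_n(s_\lambda)=s_\lambda(1,q,\ldots,q^{n-1})$ is the principal specialization.
   Context: $[m]_q=\frac{1-q^m}{1-q}$, $[m]_q!=[1]_q[2]_q\cdots[m]_q$, $\begin{bmatrix} n\\ k\end{bmatrix}_q=\frac{[n]_q!}{[k]_q!\,[n-k]_q!}$. $s_\lambda$ is the Schur function indexed by $\lambda$, and $(3^k)$ is the partition with $k$ parts equal to $3$ ($(3^0)=\varnothing$, $s_\varnothing=1$). *)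

theory Defs
  imports
    "HOL-Library.FuncSet"
    "HOL-Computational_Algebra.Polynomial"
    "HOL-Computational_Algebra.Fraction_Field"
begin

definition q_int :: "'a::field \<Rightarrow> nat \<Rightarrow> 'a" where
  "q_int q m = (1 - q ^ m) / (1 - q)"

definition q_fact :: "'a::field \<Rightarrow> nat \<Rightarrow> 'a" where
  "q_fact q m = (\<Prod>i=1..m. q_int q i)"

text \<open>Only meaningful for \<open>k \<le> n\<close>, because of the truncated subtraction.\<close>

definition q_binom :: "'a::field \<Rightarrow> nat \<Rightarrow> nat \<Rightarrow> 'a" where
  "q_binom q n k = q_fact q n / (q_fact q k * q_fact q (n - k))"

text \<open>The division by two in the exponent is exact, and for \<open>k = 0\<close> the exponent is \<open>0\<close>.\<close>

definition q_baxter :: "'a::field \<Rightarrow> nat \<Rightarrow> nat \<Rightarrow> 'a" where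
  "q_baxter q n k =
     q ^ (3 * k * (k - 1) div 2) *
     ((q_binom q n k * q_binom q (n + 1) k * q_binom q (n + 2) k) /
      (q_binom q (k + 1) k * q_binom q (k + 2) k))"

text \<open>
  A partition is the list of its parts in weakly decreasing order. Its cells are the pairs
  (row, column), both counted from \<open>0\<close>, in English notation.
\<close>

definition cells :: "nat list \<Rightarrow> (nat \<times> nat) set" where
  "cells \<mu> = {(i, j). i < length \<mu> \<and> j < \<mu> ! i}"

text \<open>
  Semistandard Young tableaux of shape \<open>\<mu>\<close> with entries in \<open>{1..n}\<close>. Using the extensional
  function space makes each tableau correspond to exactly one function.
\<close>

definition ssyt :: "nat list \<Rightarrow> nat \<Rightarrow> (nat \<times> nat \<Rightarrow> nat) set" where
  "ssyt \<mu> n = {T \<in> cells \<mu> \<rightarrow>\<^sub>E {1..n}.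
     (\<forall>i j j'. j < j' \<longrightarrow> (i, j) \<in> cells \<mu> \<longrightarrow> (i, j') \<in> cells \<mu> \<longrightarrow> T (i, j) \<le> T (i, j')) \<and>
     (\<forall>i i' j. i < i' \<longrightarrow> (i, j) \<in> cells \<mu> \<longrightarrow> (i', j) \<in> cells \<mu> \<longrightarrow> T (i, j) < T (i', j))}"

text \<open>
  \<open>schur \<mu> n x\<close> is the value of the Schur function at \<open>(x 1, \<dots>, x n)\<close>, the remaining variables
  being \<open>0\<close>. Only the values \<open>x 1, \<dots>, x n\<close> matter.
\<close>

definition schur :: "nat list \<Rightarrow> nat \<Rightarrow> (nat \<Rightarrow> 'a::comm_ring_1) \<Rightarrow> 'a" where
  "schur \<mu> n x = (\<Sum>T\<in>ssyt \<mu> n. \<Prod>c\<in>cells \<mu>. x (T c))"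

text \<open>
  A symmetric function is given here by the family of its evaluations in finitely many variables.
\<close>

definition ps :: "'a::comm_ring_1 \<Rightarrow> nat \<Rightarrow> (nat \<Rightarrow> (nat \<Rightarrow> 'a) \<Rightarrow> 'a) \<Rightarrow> 'a" where
  "ps q n f = f n (\<lambda>i. q ^ (i - 1))"

text \<open>The indeterminate \<open>q\<close> of the field of rational functions over the rational numbers.\<close>

definition indet :: "rat poly fract" where
  "indet = Fract [:0, 1:] 1"

end

theory Submission
  imports Defs
begin

text \<open>
  The Schur function of a shape with columns of heights \<open>a \<ge> b \<ge> c\<close> is computed by removing the
  largest letter. In a tableau with entries in \<open>{1..n + 1}\<close> the letter \<open>n + 1\<close> occupies at most one
  cell of each column, namely the bottom one, and what is left is a tableau with entries in
  \<open>{1..n}\<close> of a smaller three-column shape (lemma \<open>branching\<close>). With the strictly decreasing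
  heights \<open>(r, s, t) = (a + 3, b + 2, c + 1)\<close> this is a recurrence over the eight ways of lowering
  \<open>r\<close>, \<open>s\<close>, \<open>t\<close> by \<open>0\<close> or \<open>1\<close>, where the triples that are no longer strictly decreasing and
  positive contribute \<open>0\<close> (lemma \<open>column_sum_Suc\<close>).

  The principal specialization satisfies the same recurrence as a product: up to a factor that
  depends on \<open>n\<close> only, it is the Vandermonde product in \<open>u = q ^ (- r)\<close>, \<open>v = q ^ (- s)\<close>, \<open>w = q ^ (- t)\<close>
  times one factor for each column, a multiple of the elementary symmetric function of degree
  \<open>r - 1\<close>, \<open>s - 1\<close> or \<open>t - 1\<close> in \<open>1, q, \<dots>, q ^ (n + 1)\<close>. The Vandermonde product vanishes where two
  heights collide, so that all eight terms may be kept. Passing from \<open>n + 1\<close> to \<open>n\<close>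
  multiplies the factor of a column by a polynomial of degree one in its variable, and lowering the
  height multiplies the variable by \<open>q\<close>. The sum over the eight choices is therefore one
  \<open>3 \<times> 3\<close> determinant with a row for each column of the shape. Its entries are triangular
  combinations of the powers of the variable, hence it is a multiple of the old Vandermonde product
  (lemmas \<open>det3_triangular\<close> and \<open>vandermonde3_step\<close>). This gives the product formula
  \<open>column_sum_principal_specialization\<close> for all three-column shapes, and for \<open>a = b = c = k\<close> the
  product is the \<open>q\<close>-Baxter number.
\<close>

section \<open>Tableaux and the branching rule\<close>

text \<open>
  Removing the largest letter from a tableau leads to sets of cells rather than to lists of parts;
  hence the shape is an arbitrary set of cells here.
\<close>

definition tableaux :: "(nat \<times> nat) set \<Rightarrow> nat \<Rightarrow> (nat \<times> nat \<Rightarrow> nat) set" where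
  "tableaux D n = {T \<in> D \<rightarrow>\<^sub>E {1..n}.
     (\<forall>i j j'. j < j' \<longrightarrow> (i, j) \<in> D \<longrightarrow> (i, j') \<in> D \<longrightarrow> T (i, j) \<le> T (i, j')) \<and>
     (\<forall>i i' j. i < i' \<longrightarrow> (i, j) \<in> D \<longrightarrow> (i', j) \<in> D \<longrightarrow> T (i, j) < T (i', j))}"

definition tableau_sum ::
    "(nat \<times> nat) set \<Rightarrow> nat \<Rightarrow> (nat \<Rightarrow> 'a::comm_ring_1) \<Rightarrow> 'a" where
  "tableau_sum D n x = (\<Sum>T\<in>tableaux D n. \<Prod>c\<in>D. x (T c))"

lemma schur_eq_tableau_sum: "schur \<mu> n x = tableau_sum (cells \<mu>) n x"
  by (simp add: schur_def tableau_sum_def ssyt_def tableaux_def)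

lemma finite_tableaux: "finite D \<Longrightarrow> finite (tableaux D n)"
  by (rule finite_subset[of _ "D \<rightarrow>\<^sub>E {1..n}"]) (auto simp: tableaux_def intro: finite_PiE)

text \<open>
  The sets that can remain when all cells with the largest letter are removed. If \<open>D\<close> is a Young
  diagram, these are the smaller diagrams whose complement in \<open>D\<close> is a horizontal strip: the last
  condition says that only the bottom cell of a column can be removed.
\<close>

definition strip_remainders :: "(nat \<times> nat) set \<Rightarrow> (nat \<times> nat) set set" where
  "strip_remainders D = {D'. D' \<subseteq> D \<and>
     (\<forall>i j j'. j < j' \<longrightarrow> (i, j') \<in> D' \<longrightarrow> (i, j) \<in> D \<longrightarrow> (i, j) \<in> D') \<and>
     (\<forall>i i' j. i < i' \<longrightarrow> (i, j) \<in> D \<longrightarrow> (i', j) \<in> D \<longrightarrow> (i, j) \<in> D')}"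

text \<open>
  Restriction to \<open>D'\<close> is a bijection onto the tableaux of shape \<open>D'\<close>; its inverse fills \<open>D - D'\<close>
  with the letter \<open>n + 1\<close>. The two conditions on strip remainders are exactly what makes the filled
  array weakly increasing along rows and strictly increasing down columns.
\<close>

lemma tableau_sum_fixed_remainder:
  fixes x :: "nat \<Rightarrow> 'a::comm_ring_1"
  assumes "finite D" "D' \<in> strip_remainders D"
  shows "(\<Sum>T | T \<in> tableaux D (Suc n) \<and> {c \<in> D. T c \<le> n} = D'. \<Prod>c\<in>D. x (T c))
       = tableau_sum D' n x * x (Suc n) ^ card (D - D')"
proof -
  define ext where "ext S = (\<lambda>c. if c \<in> D' then S c else if c \<in> D then Suc n else undefined)"
    for S :: "nat \<times> nat \<Rightarrow> nat"
  have sub: "D' \<subseteq> D"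
    and row: "\<And>i j j'. j < j' \<Longrightarrow> (i, j') \<in> D' \<Longrightarrow> (i, j) \<in> D \<Longrightarrow> (i, j) \<in> D'"
    and col: "\<And>i i' j. i < i' \<Longrightarrow> (i, j) \<in> D \<Longrightarrow> (i', j) \<in> D \<Longrightarrow> (i, j) \<in> D'"
    using assms(2) unfolding strip_remainders_def by blast+
  have "(\<Sum>T | T \<in> tableaux D (Suc n) \<and> {c \<in> D. T c \<le> n} = D'. \<Prod>c\<in>D. x (T c))
      = (\<Sum>S\<in>tableaux D' n. (\<Prod>c\<in>D'. x (S c)) * x (Suc n) ^ card (D - D'))"
  proof (rule sum.reindex_bij_witness[where i = ext and j = "\<lambda>T. restrict T D'"])
    fix T assume T: "T \<in> {T. T \<in> tableaux D (Suc n) \<and> {c \<in> D. T c \<le> n} = D'}"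
    then have TD: "T \<in> D \<rightarrow>\<^sub>E {1..Suc n}" and D': "\<And>c. c \<in> D' \<longleftrightarrow> c \<in> D \<and> T c \<le> n"
      by (auto simp: tableaux_def)
    have top: "T c = Suc n" if "c \<in> D" "c \<notin> D'" for c
      using PiE_mem[OF TD that(1)] that D'[of c] by auto
    show "ext (restrict T D') = T"
      using top PiE_arb[OF TD] D' by (auto simp: ext_def fun_eq_iff)
    show "restrict T D' \<in> tableaux D' n"
      using T sub D' by (auto simp: tableaux_def PiE_iff)
    have "(\<Prod>c\<in>D. x (T c)) = (\<Prod>c\<in>D - D'. x (T c)) * (\<Prod>c\<in>D'. x (T c))"
      by (rule prod.subset_diff[OF sub assms(1)])
    also have "(\<Prod>c\<in>D - D'. x (T c)) = x (Suc n) ^ card (D - D')"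
      using top by simp
    finally show "(\<Prod>c\<in>D'. x (restrict T D' c)) * x (Suc n) ^ card (D - D') = (\<Prod>c\<in>D. x (T c))"
      by (simp add: mult.commute)
  next
    fix S assume S: "S \<in> tableaux D' n"
    then have SD: "S \<in> D' \<rightarrow>\<^sub>E {1..n}"
      and Srow: "\<And>i j j'. j < j' \<Longrightarrow> (i, j) \<in> D' \<Longrightarrow> (i, j') \<in> D' \<Longrightarrow> S (i, j) \<le> S (i, j')"
      and Scol: "\<And>i i' j. i < i' \<Longrightarrow> (i, j) \<in> D' \<Longrightarrow> (i', j) \<in> D' \<Longrightarrow> S (i, j) < S (i', j)"
      by (auto simp: tableaux_def)
    have rng: "1 \<le> S c \<and> S c \<le> n" if "c \<in> D'" for c
      using PiE_mem[OF SD that] by simp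
    show "restrict (ext S) D' = S"
      using PiE_arb[OF SD] by (auto simp: ext_def fun_eq_iff)
    have "ext S \<in> D \<rightarrow>\<^sub>E {1..Suc n}"
      using rng sub by (auto simp: ext_def PiE_iff extensional_def le_Suc_eq)
    moreover have "ext S (i, j) \<le> ext S (i, j')" if "j < j'" "(i, j) \<in> D" "(i, j') \<in> D" for i j j'
      using that row Srow rng by (auto simp: ext_def le_Suc_eq)
    moreover have "ext S (i, j) < ext S (i', j)" if "i < i'" "(i, j) \<in> D" "(i', j) \<in> D" for i i' j
      using that col[OF that] Scol rng by (auto simp: ext_def less_Suc_eq_le)
    ultimately have "ext S \<in> tableaux D (Suc n)"
      by (auto simp: tableaux_def)
    moreover have "{c \<in> D. ext S c \<le> n} = D'"
      using rng sub by (auto simp: ext_def)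
    ultimately show "ext S \<in> {T. T \<in> tableaux D (Suc n) \<and> {c \<in> D. T c \<le> n} = D'}"
      by simp
  qed
  then show ?thesis
    by (simp add: tableau_sum_def sum_distrib_right)
qed

text \<open>Tableaux are grouped by the set of cells whose entry is not the largest letter.\<close>

lemma branching:
  fixes x :: "nat \<Rightarrow> 'a::comm_ring_1"
  assumes "finite D"
  shows "tableau_sum D (Suc n) x =
    (\<Sum>D'\<in>strip_remainders D. tableau_sum D' n x * x (Suc n) ^ card (D - D'))"
proof -
  have fin: "finite (strip_remainders D)"
    by (rule finite_subset[of _ "Pow D"]) (auto simp: strip_remainders_def assms)
  have maps: "{c \<in> D. T c \<le> n} \<in> strip_remainders D" if "T \<in> tableaux D (Suc n)" for T
  proof -
    have "T (i, j) \<le> n" if "i < i'" "(i, j) \<in> D" "(i', j) \<in> D" for i i' j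
    proof -
      have "T (i, j) < T (i', j)" "T (i', j) \<le> Suc n"
        using \<open>T \<in> tableaux D (Suc n)\<close> that by (auto simp: tableaux_def PiE_iff)
      then show ?thesis by simp
    qed
    moreover have "T (i, j) \<le> n" if "j < j'" "(i, j) \<in> D" "(i, j') \<in> D" "T (i, j') \<le> n" for i j j'
    proof -
      have "T (i, j) \<le> T (i, j')"
        using \<open>T \<in> tableaux D (Suc n)\<close> that(1-3) unfolding tableaux_def by blast
      then show ?thesis using that(4) by simp
    qed
    ultimately show ?thesis
      unfolding strip_remainders_def by blast
  qed
  have "tableau_sum D (Suc n) x
      = (\<Sum>D'\<in>strip_remainders D.
          \<Sum>T | T \<in> tableaux D (Suc n) \<and> {c \<in> D. T c \<le> n} = D'. \<Prod>c\<in>D. x (T c))"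
    unfolding tableau_sum_def
    by (rule sum.group[symmetric]) (use maps fin finite_tableaux[OF assms] in auto)
  also have "\<dots> = (\<Sum>D'\<in>strip_remainders D. tableau_sum D' n x * x (Suc n) ^ card (D - D'))"
    by (intro sum.cong refl tableau_sum_fixed_remainder assms)
  finally show ?thesis .
qed

section \<open>Shapes with three columns\<close>

text \<open>
  The parameters are the column heights increased by \<open>3\<close>, \<open>2\<close> and \<open>1\<close>. The shift turns weakly
  decreasing heights into strictly decreasing positive numbers, so that a step that does not lead to
  a Young diagram makes two parameters equal or the last one \<open>0\<close>.
\<close>

definition three_columns :: "nat \<Rightarrow> nat \<Rightarrow> nat \<Rightarrow> (nat \<times> nat) set" where
  "three_columns r s t =
     {..<r - 3} \<times> {0} \<union> {..<s - 2} \<times> {1} \<union> {..<t - 1} \<times> {2}"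

lemma finite_three_columns [simp]: "finite (three_columns r s t)"
  by (simp add: three_columns_def)

lemma card_three_columns: "card (three_columns r s t) = (r - 3) + (s - 2) + (t - 1)"
  unfolding three_columns_def
  by (subst card_Un_disjoint; (auto simp: card_cartesian_product)?)+

lemma mem_three_columns:
  "(i, j) \<in> three_columns r s t \<longleftrightarrow>
     j = 0 \<and> i + 3 < r \<or> j = 1 \<and> i + 2 < s \<or> j = 2 \<and> i + 1 < t"
  by (auto simp: three_columns_def)

lemma cells_replicate_3: "cells (replicate k 3) = three_columns (k + 3) (k + 2) (k + 1)"
  by (auto simp: cells_def mem_three_columns)

definition admissible_steps :: "nat \<Rightarrow> nat \<Rightarrow> nat \<Rightarrow> (nat \<times> nat \<times> nat) set" where
  "admissible_steps r s t = {(d, e, f) \<in> {0, 1} \<times> {0, 1} \<times> {0, 1}.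
     r - d > s - e \<and> s - e > t - f \<and> t - f > 0}"

lemma three_columns_inj:
  assumes "three_columns r s t = three_columns r' s' t'"
    and "r > s" "s > t" "t > 0" "r' > s'" "s' > t'" "t' > 0"
  shows "r = r' \<and> s = s' \<and> t = t'"
proof -
  have eq: "(i, j) \<in> three_columns r s t \<longleftrightarrow> (i, j) \<in> three_columns r' s' t'" for i j
    using assms(1) by simp
  have "i + 3 < r \<longleftrightarrow> i + 3 < r'" "i + 2 < s \<longleftrightarrow> i + 2 < s'" "i + 1 < t \<longleftrightarrow> i + 1 < t'" for i
    using eq[of i 0] eq[of i 1] eq[of i 2] by (simp_all add: mem_three_columns)
  from this(1)[of "r - 3"] this(1)[of "r' - 3"] this(2)[of "s - 2"] this(2)[of "s' - 2"]
    this(3)[of "t - 1"] this(3)[of "t' - 1"]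
  show ?thesis using assms(2-) by auto
qed

text \<open>
  A strip remainder of a three-column shape is determined by the columns that lose their bottom
  cell. Row closure of the remainder is what keeps the lowered heights strictly decreasing.
\<close>

lemma bij_betw_admissible_steps:
  assumes "r > s" "s > t" "t > 0"
  shows "bij_betw (\<lambda>(d, e, f). three_columns (r - d) (s - e) (t - f))
           (admissible_steps r s t) (strip_remainders (three_columns r s t))"
proof (rule bij_betw_imageI)
  show "inj_on (\<lambda>(d, e, f). three_columns (r - d) (s - e) (t - f)) (admissible_steps r s t)"
  proof (rule inj_onI)
    fix p p'
    assume p: "p \<in> admissible_steps r s t" "p' \<in> admissible_steps r s t"
      "(\<lambda>(d, e, f). three_columns (r - d) (s - e) (t - f)) p
       = (\<lambda>(d, e, f). three_columns (r - d) (s - e) (t - f)) p'"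
    obtain d e f d' e' f' where pp: "p = (d, e, f)" "p' = (d', e', f')"
      by (metis prod_cases3)
    have *: "(d, e, f) \<in> admissible_steps r s t" "(d', e', f') \<in> admissible_steps r s t"
      "three_columns (r - d) (s - e) (t - f) = three_columns (r - d') (s - e') (t - f')"
      using p by (auto simp: pp)
    have "r - d > s - e" "s - e > t - f" "t - f > 0" "r - d' > s - e'" "s - e' > t - f'" "t - f' > 0"
      using *(1,2) unfolding admissible_steps_def by blast+
    from three_columns_inj[OF *(3) this]
    have "r - d = r - d'" "s - e = s - e'" "t - f = t - f'" by blast+
    moreover have "d \<le> 1" "d' \<le> 1" "e \<le> 1" "e' \<le> 1" "f \<le> 1" "f' \<le> 1"
      using *(1,2) by (auto simp: admissible_steps_def)
    ultimately show "p = p'"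
      unfolding pp prod.inject using assms by (intro conjI) linarith+
  qed
  show "(\<lambda>(d, e, f). three_columns (r - d) (s - e) (t - f)) ` admissible_steps r s t
      = strip_remainders (three_columns r s t)" (is "?L = ?R")
  proof (intro set_eqI iffI)
    fix D' assume "D' \<in> ?L"
    then obtain d e f where def: "(d, e, f) \<in> admissible_steps r s t"
      and D': "D' = three_columns (r - d) (s - e) (t - f)" by auto
    have *: "s + d < r + e" "t + e < s + f" "d \<le> 1" "e \<le> 1" "f \<le> 1"
      using def assms by (auto simp: admissible_steps_def)
    have mem: "(i, j) \<in> D' \<longleftrightarrow>
        j = 0 \<and> i + 3 + d < r \<or> j = 1 \<and> i + 2 + e < s \<or> j = 2 \<and> i + 1 + f < t" for i j
      by (simp add: D' mem_three_columns less_diff_conv)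
    show "D' \<in> ?R"
      unfolding strip_remainders_def mem_Collect_eq
    proof (intro conjI allI impI subrelI)
      show "(i, j) \<in> D' \<Longrightarrow> (i, j) \<in> three_columns r s t" for i j
        unfolding mem mem_three_columns by (elim disjE) simp_all
      show "(i, j) \<in> D'" if "j < j'" "(i, j') \<in> D'" "(i, j) \<in> three_columns r s t" for i j j'
        using that(2,3,1) * unfolding mem mem_three_columns by (elim disjE) simp_all
      show "(i, j) \<in> D'" if "i < i'" "(i, j) \<in> three_columns r s t"
        "(i', j) \<in> three_columns r s t" for i i' j
        using that(2,3,1) * unfolding mem mem_three_columns by (elim disjE) simp_all
    qed
  next
    fix D' assume "D' \<in> ?R"
    then have sub: "D' \<subseteq> three_columns r s t"
      and row: "\<And>i j j'. j < j' \<Longrightarrow> (i, j') \<in> D' \<Longrightarrow> (i, j) \<in> three_columns r s t \<Longrightarrow> (i, j) \<in> D'"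
      and col: "\<And>i i' j. i < i' \<Longrightarrow> (i, j) \<in> three_columns r s t \<Longrightarrow>
                  (i', j) \<in> three_columns r s t \<Longrightarrow> (i, j) \<in> D'"
      unfolding strip_remainders_def by blast+
    \<comment> \<open>a column loses its bottom cell if it is not empty and this cell is outside \<open>D'\<close>\<close>
    define d :: nat where "d = (if r > 3 \<and> (r - 4, 0) \<notin> D' then 1 else 0)"
    define e :: nat where "e = (if s > 2 \<and> (s - 3, 1) \<notin> D' then 1 else 0)"
    define f :: nat where "f = (if t > 1 \<and> (t - 2, 2) \<notin> D' then 1 else 0)"
    have bits: "d \<le> 1" "e \<le> 1" "f \<le> 1"
      unfolding d_def e_def f_def by simp_all
    have d1: "r > 3 \<and> (r - 4, 0) \<notin> D'" if "d = 1"
      using that unfolding d_def by (metis zero_neq_one)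
    have e1: "s > 2 \<and> (s - 3, 1) \<notin> D'" if "e = 1"
      using that unfolding e_def by (metis zero_neq_one)
    have f1: "t > 1" if "f = 1"
      using that unfolding f_def by (metis zero_neq_one)
    have c0: "(i, 0) \<in> D' \<longleftrightarrow> i + 3 < r - d" for i
      using subsetD[OF sub, of "(i, 0)"] col[of i "r - 4" 0] assms
      unfolding mem_three_columns d_def by (cases "i = r - 4") (simp; linarith)+
    have c1: "(i, 1) \<in> D' \<longleftrightarrow> i + 2 < s - e" for i
      using subsetD[OF sub, of "(i, 1)"] col[of i "s - 3" 1] assms
      unfolding mem_three_columns e_def by (cases "i = s - 3") (simp; linarith)+
    have c2: "(i, 2) \<in> D' \<longleftrightarrow> i + 1 < t - f" for i
      using subsetD[OF sub, of "(i, 2)"] col[of i "t - 2" 2] assms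
      unfolding mem_three_columns f_def by (cases "i = t - 2") (simp; linarith)+
    have cj: "(i, j) \<notin> D'" if "j \<noteq> 0" "j \<noteq> 1" "j \<noteq> 2" for i j
      using sub that by (auto simp: mem_three_columns)
    have "(i, j) \<in> D' \<longleftrightarrow> (i, j) \<in> three_columns (r - d) (s - e) (t - f)" for i j
    proof -
      consider "j = 0" | "j = 1" | "j = 2" | "j \<noteq> 0" "j \<noteq> 1" "j \<noteq> 2" by blast
      then show ?thesis
        unfolding mem_three_columns by cases (use c0 c1 c2 cj in simp_all)
    qed
    then have "D' = three_columns (r - d) (s - e) (t - f)"
      by (simp only: set_eq_iff split_paired_All) simp
    moreover have "r - d > s - e"
    proof (rule ccontr)
      assume "\<not> r - d > s - e"
      then have "d = 1" using assms bits by linarith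
      moreover have "r - 4 + 2 < s - e"
        using \<open>\<not> r - d > s - e\<close> d1[OF \<open>d = 1\<close>] assms bits by linarith
      moreover from this have "(r - 4, 1) \<in> D'" using c1 by blast
      moreover have "(r - 4, 0) \<in> three_columns r s t"
        using d1[OF \<open>d = 1\<close>] by (simp add: mem_three_columns)
      ultimately show False using row[of 0 1 "r - 4"] d1 by simp
    qed
    moreover have "s - e > t - f"
    proof (rule ccontr)
      assume "\<not> s - e > t - f"
      then have "e = 1" using assms bits by linarith
      moreover have "s - 3 + 1 < t - f"
        using \<open>\<not> s - e > t - f\<close> e1[OF \<open>e = 1\<close>] assms bits by linarith
      moreover from this have "(s - 3, 2) \<in> D'" using c2 by blast
      moreover have "(s - 3, 1) \<in> three_columns r s t"
        using e1[OF \<open>e = 1\<close>] by (simp add: mem_three_columns) linarith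
      ultimately show False using row[of 1 2 "s - 3"] e1 by simp
    qed
    moreover have "t - f > 0" using assms bits f1 by (cases "f = 1") auto
    moreover have "d \<in> {0, 1}" "e \<in> {0, 1}" "f \<in> {0, 1}"
      unfolding d_def e_def f_def by simp_all
    ultimately have "(d, e, f) \<in> admissible_steps r s t"
      unfolding admissible_steps_def by blast
    then show "D' \<in> ?L"
      by (rule rev_image_eqI)
        (simp only: prod.case \<open>D' = three_columns (r - d) (s - e) (t - f)\<close>)
  qed
qed

text \<open>
  The value \<open>0\<close> outside the strictly decreasing positive triples makes the recurrence
  \<open>column_sum_Suc\<close> uniform in the eight steps.
\<close>

definition column_sum :: "nat \<Rightarrow> (nat \<Rightarrow> 'a::comm_ring_1) \<Rightarrow> nat \<Rightarrow> nat \<Rightarrow> nat \<Rightarrow> 'a" where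
  "column_sum n x r s t =
     (if r > s \<and> s > t \<and> t > 0 then tableau_sum (three_columns r s t) n x else 0)"

lemma column_sum_Suc:
  assumes "r > s" "s > t" "t > 0"
  shows "column_sum (Suc n) x r s t =
    (\<Sum>(d, e, f)\<in>{0, 1} \<times> {0, 1} \<times> {0, 1}.
       column_sum n x (r - d) (s - e) (t - f) * x (Suc n) ^ (d + e + f))"
proof -
  let ?D = "three_columns r s t"
  have "column_sum (Suc n) x r s t =
      (\<Sum>D'\<in>strip_remainders ?D. tableau_sum D' n x * x (Suc n) ^ card (?D - D'))"
    using assms by (simp add: column_sum_def branching)
  also have "\<dots> = (\<Sum>(d, e, f)\<in>admissible_steps r s t.
      tableau_sum (three_columns (r - d) (s - e) (t - f)) n x
        * x (Suc n) ^ card (?D - three_columns (r - d) (s - e) (t - f)))"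
    by (subst sum.reindex_bij_betw[OF bij_betw_admissible_steps[OF assms], symmetric])
       (simp add: case_prod_unfold)
  also have "\<dots> = (\<Sum>(d, e, f)\<in>admissible_steps r s t.
      column_sum n x (r - d) (s - e) (t - f) * x (Suc n) ^ (d + e + f))"
  proof (intro sum.cong refl, clarify)
    fix d e f assume *: "(d, e, f) \<in> admissible_steps r s t"
    have "three_columns (r - d) (s - e) (t - f) \<subseteq> ?D"
      by (auto simp: three_columns_def)
    then have "card (?D - three_columns (r - d) (s - e) (t - f)) = d + e + f"
      using * assms by (subst card_Diff_subset) (auto simp: card_three_columns admissible_steps_def)
    then show "tableau_sum (three_columns (r - d) (s - e) (t - f)) n x
        * x (Suc n) ^ card (?D - three_columns (r - d) (s - e) (t - f))
      = column_sum n x (r - d) (s - e) (t - f) * x (Suc n) ^ (d + e + f)"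
      using * by (simp add: column_sum_def admissible_steps_def)
  qed
  also have "\<dots> = (\<Sum>(d, e, f)\<in>{0, 1} \<times> {0, 1} \<times> {0, 1}.
       column_sum n x (r - d) (s - e) (t - f) * x (Suc n) ^ (d + e + f))"
  proof (rule sum.mono_neutral_left)
    show "\<forall>p\<in>{0, 1} \<times> {0, 1} \<times> {0, 1} - admissible_steps r s t.
      (case p of (d, e, f) \<Rightarrow>
        column_sum n x (r - d) (s - e) (t - f) * x (Suc n) ^ (d + e + f)) = 0"
    proof
      fix p assume p: "p \<in> {0, 1} \<times> {0, 1} \<times> {0, 1} - admissible_steps r s t"
      obtain d e f where "p = (d, e, f)" by (rule prod_cases3)
      with p have "\<not> (r - d > s - e \<and> s - e > t - f \<and> t - f > 0)"
        unfolding admissible_steps_def by blast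
      then show "(case p of (d, e, f) \<Rightarrow>
          column_sum n x (r - d) (s - e) (t - f) * x (Suc n) ^ (d + e + f)) = 0"
        by (simp only: \<open>p = (d, e, f)\<close> column_sum_def prod.case if_False mult_zero_left)
    qed
  qed (auto simp: admissible_steps_def)
  finally show ?thesis .
qed

lemma column_sum_0:
  assumes "r > s" "s > t" "t > 0"
  shows "column_sum 0 x r s t = (if r = 3 then 1 else 0)"
proof (cases "r = 3")
  case True
  then have "three_columns r s t = {}" using assms by (auto simp: three_columns_def)
  then show ?thesis using assms True
    by (simp add: column_sum_def tableau_sum_def tableaux_def)
next
  case False
  then have "(0, 0) \<in> three_columns r s t" using assms by (auto simp: mem_three_columns)
  then have "tableaux (three_columns r s t) 0 = {}"
    by (auto simp: tableaux_def PiE_iff)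
  then show ?thesis using assms False by (simp add: column_sum_def tableau_sum_def)
qed

section \<open>An eight-term identity for the Vandermonde product\<close>

definition vandermonde3 :: "'a::comm_ring_1 \<Rightarrow> 'a \<Rightarrow> 'a \<Rightarrow> 'a" where
  "vandermonde3 u v w = (u - v) * (u - w) * (v - w)"

text \<open>
  The determinant with rows \<open>a\<close>, \<open>b\<close>, \<open>c\<close>, expanded along \<open>a\<close>, with the columns indexed by
  \<open>2, 1, 0\<close> in this order. For rows of powers this order gives \<open>vandermonde3\<close> with a positive sign.
\<close>

definition det3 :: "(nat \<Rightarrow> 'a::comm_ring_1) \<Rightarrow> (nat \<Rightarrow> 'a) \<Rightarrow> (nat \<Rightarrow> 'a) \<Rightarrow> 'a" where
  "det3 a b c = a 2 * (b 1 * c 0 - b 0 * c 1) - a 1 * (b 2 * c 0 - b 0 * c 2)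
     + a 0 * (b 2 * c 1 - b 1 * c 2)"

lemma det3_add:
  "det3 (\<lambda>j. a j + a' j) b c = det3 a b c + det3 a' b c"
  "det3 a (\<lambda>j. b j + b' j) c = det3 a b c + det3 a b' c"
  "det3 a b (\<lambda>j. c j + c' j) = det3 a b c + det3 a b c'"
  by (simp_all add: det3_def algebra_simps)

lemma det3_scale_powers:
  "det3 (\<lambda>j. x * u ^ j) (\<lambda>j. y * v ^ j) (\<lambda>j. z * w ^ j) = x * y * z * vandermonde3 u v w"
  by (simp add: det3_def vandermonde3_def algebra_simps power2_eq_square)

text \<open>
  Entry \<open>j\<close> of each row is a combination of \<open>z ^ j\<close> and \<open>z ^ (j + 1)\<close> with coefficients that do not
  depend on the row, and the last entry has no \<open>z ^ 3\<close>. Column operations thus reduce the matrix to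
  the Vandermonde matrix with rescaled columns.
\<close>

lemma det3_triangular:
  assumes "\<And>z. g z 0 = \<alpha> + \<alpha>' * z"
    and "\<And>z. g z 1 = \<beta> * z + \<beta>' * z ^ 2"
    and "\<And>z. g z 2 = \<gamma> * z ^ 2"
  shows "det3 (g u) (g v) (g w) = \<alpha> * \<beta> * \<gamma> * vandermonde3 u v w"
  unfolding det3_def vandermonde3_def assms
  by (simp add: algebra_simps power2_eq_square)

text \<open>
  With \<open>Q = q ^ n\<close>, the factors for \<open>0\<close> and \<open>1\<close> are those by which a column factor changes when the
  height of the column is kept or lowered (lemmas \<open>column_factor_stay\<close> and \<open>column_factor_drop\<close>), the
  second including the weight \<open>q ^ n\<close> of the removed cell. Since the determinant is additive in each
  row, the sum over the eight choices is the determinant whose rows are the sums over the two choices.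
  In these rows the coefficient of \<open>z ^ (j + 1)\<close> is \<open>Q * (q ^ (j + 2) - q ^ 4)\<close>, which vanishes for
  \<open>j = 2\<close>.
\<close>

lemma vandermonde3_step:
  fixes q Q u v w :: "'a::comm_ring_1"
  shows "(\<Sum>(d, e, f)\<in>{0, 1 :: nat} \<times> {0, 1 :: nat} \<times> {0, 1 :: nat}.
      (if d = 0 then 1 - Q * q ^ 4 * u else Q * (q * (q * u - 1))) *
      (if e = 0 then 1 - Q * q ^ 4 * v else Q * (q * (q * v - 1))) *
      (if f = 0 then 1 - Q * q ^ 4 * w else Q * (q * (q * w - 1))) *
      vandermonde3 (q ^ d * u) (q ^ e * v) (q ^ f * w))
    = (1 - Q * q) * (1 - Q * q ^ 2) * (1 - Q * q ^ 3) * vandermonde3 u v w"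
    (is "?lhs = ?rhs")
proof -
  define g where "g z j = (1 - Q * q ^ 4 * z) * z ^ j + Q * (q * (q * z - 1)) * (q * z) ^ j"
    for z and j :: nat
  have "?lhs = det3 (g u) (g v) (g w)"
    unfolding g_def det3_add det3_scale_powers
    by (simp add: sum.cartesian_product[symmetric])
  also have "\<dots> = ?rhs"
  proof (rule det3_triangular)
    show "g z 0 = (1 - Q * q) + (Q * q ^ 2 - Q * q ^ 4) * z" for z
      by (simp add: g_def algebra_simps eval_nat_numeral)
    show "g z 1 = (1 - Q * q ^ 2) * z + (Q * q ^ 3 - Q * q ^ 4) * z ^ 2" for z
      by (simp add: g_def algebra_simps eval_nat_numeral)
    show "g z 2 = (1 - Q * q ^ 3) * z ^ 2" for z
      by (simp add: g_def algebra_simps eval_nat_numeral)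
  qed
  finally show ?thesis .
qed

section \<open>The product formula\<close>

text \<open>
  For \<open>0 < s \<le> N + 1\<close> this is \<open>1 / q_fact q N\<close> times the elementary symmetric function of degree
  \<open>s - 1\<close> in \<open>1, q, \<dots>, q ^ (N - 1)\<close>, by the \<open>q\<close>-binomial theorem. The value \<open>0\<close> elsewhere lets the two
  recurrences below hold at the boundary: there is no column of negative height, and none that is
  too long for strict increase.
\<close>

definition column_factor :: "'a::field \<Rightarrow> nat \<Rightarrow> nat \<Rightarrow> 'a" where
  "column_factor q N s = (if 0 < s \<and> s \<le> Suc N
     then q ^ ((s - 1) choose 2) / (q_fact q (s - 1) * q_fact q (Suc N - s)) else 0)"

text \<open>
  The constants \<open>q ^ 7\<close> and \<open>(1 - q) ^ 3\<close> normalize the value to \<open>1\<close> at the empty shape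
  \<open>(3, 2, 1)\<close>, and the three factorials absorb the factor
  \<open>(1 - q ^ (n + 1)) * (1 - q ^ (n + 2)) * (1 - q ^ (n + 3))\<close> of \<open>vandermonde3_step\<close>, divided by the
  three factors \<open>1 - q\<close> that the recurrences of the column factors contribute.
\<close>

definition column_product :: "'a::field \<Rightarrow> nat \<Rightarrow> nat \<Rightarrow> nat \<Rightarrow> nat \<Rightarrow> 'a" where
  "column_product q n r s t =
     q_fact q n * q_fact q (n + 1) * q_fact q (n + 2) * q ^ 7 / (1 - q) ^ 3 *
     vandermonde3 (inverse q ^ r) (inverse q ^ s) (inverse q ^ t) *
     (column_factor q (n + 2) r * column_factor q (n + 2) s * column_factor q (n + 2) t)"

lemma q_fact_Suc: "q_fact q (Suc m) = q_fact q m * q_int q (Suc m)"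
  by (simp add: q_fact_def)

lemma q_fact_nonzero:
  fixes q :: "'a::field"
  assumes "\<And>m. m > 0 \<Longrightarrow> q ^ m \<noteq> 1"
  shows "q_fact q m \<noteq> 0"
  using assms assms[of 1] by (auto simp: q_fact_def q_int_def)

lemma column_factor_stay:
  fixes q :: "'a::field"
  assumes "q \<noteq> 0" and nr: "\<And>m. m > 0 \<Longrightarrow> q ^ m \<noteq> 1" and "s > 0"
  shows "column_factor q N s =
    (1 - q ^ (N + 2) * inverse q ^ s) / (1 - q) * column_factor q (Suc N) s"
proof (cases "s \<le> Suc N")
  case True
  then obtain d where d: "Suc N = s + d" using le_Suc_ex by blast
  have "q ^ (N + 2) = q ^ Suc d * q ^ s"
    using d by (simp flip: power_add) (simp add: add.commute)
  then have "q ^ (N + 2) * inverse q ^ s = q ^ Suc d"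
    using assms(1) by (simp add: power_inverse)
  then have int: "(1 - q ^ (N + 2) * inverse q ^ s) / (1 - q) = q_int q (Suc d)"
    by (simp add: q_int_def)
  have "q_int q (Suc d) \<noteq> 0"
    using nr[of "Suc d"] nr[of 1] by (simp add: q_int_def)
  moreover have "Suc N - s = d" "Suc (Suc N) - s = Suc d" using d by auto
  ultimately show ?thesis
    unfolding int using True by (simp add: column_factor_def q_fact_Suc)
next
  case False
  show ?thesis
  proof (cases "s = Suc (Suc N)")
    case True
    then have "q ^ (N + 2) * inverse q ^ s = 1"
      using assms(1) by (simp add: power_inverse del: power_Suc)
    then show ?thesis using False by (simp add: column_factor_def)
  qed (use False in \<open>simp add: column_factor_def\<close>)
qed

lemma column_factor_drop:
  fixes q :: "'a::field"
  assumes "q \<noteq> 0" and nr: "\<And>m. m > 0 \<Longrightarrow> q ^ m \<noteq> 1" and "s > 0"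
  shows "column_factor q N (s - 1) =
    q * (q * inverse q ^ s - 1) / (1 - q) * column_factor q (Suc N) s"
proof (cases s)
  case (Suc l)
  show ?thesis
  proof (cases l)
    case 0
    then show ?thesis using Suc assms(1) by (simp add: column_factor_def)
  next
    case (Suc p)
    have s: "s = Suc (Suc p)" using Suc \<open>s = Suc l\<close> by simp
    have ch: "Suc p choose 2 = (p choose 2) + p"
      by (simp add: numeral_2_eq_2)
    define c where "c = q * (q * inverse q ^ s - 1)"
    have "c * q ^ p = 1 - q ^ Suc p"
      using assms(1) by (simp add: c_def s power_inverse field_simps)
    moreover have "c * q ^ (Suc p choose 2) = c * q ^ p * q ^ (p choose 2)"
      by (simp add: ch power_add ac_simps)
    ultimately have int: "c * q ^ (Suc p choose 2) / (1 - q) = q_int q (Suc p) * q ^ (p choose 2)"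
      by (simp add: q_int_def)
    have "q_int q (Suc p) \<noteq> 0"
      using nr[of "Suc p"] nr[of 1] by (simp add: q_int_def)
    then have "q ^ (p choose 2) / (q_fact q p * g)
        = q_int q (Suc p) * q ^ (p choose 2) / (q_fact q (Suc p) * g)" for g
      by (simp add: q_fact_Suc)
    then have step: "q ^ (p choose 2) / (q_fact q p * g)
        = c / (1 - q) * (q ^ (Suc p choose 2) / (q_fact q (Suc p) * g))" for g
      by (simp flip: int)
    show ?thesis
    proof (cases "p \<le> N")
      case True
      then have "column_factor q N (s - 1) = q ^ (p choose 2) / (q_fact q p * q_fact q (N - p))"
        "column_factor q (Suc N) s
          = q ^ (Suc p choose 2) / (q_fact q (Suc p) * q_fact q (N - p))"
        by (simp_all add: column_factor_def s)
      then show ?thesis unfolding c_def[symmetric] by (simp only: step)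
    next
      case False
      then show ?thesis by (simp add: column_factor_def s)
    qed
  qed
qed (use assms in simp)


text \<open>
  Each summand on the right is the product of the constant \<open>K * C / (1 - q) ^ 3\<close> with a summand of
  \<open>vandermonde3_step\<close>, because \<open>column_factor_stay\<close> and \<open>column_factor_drop\<close> express the factors for
  \<open>n + 2\<close> by the unlowered factors for \<open>n + 3\<close>.
\<close>

lemma column_product_Suc:
  fixes q :: "'a::field"
  assumes "q \<noteq> 0" and nr: "\<And>m. m > 0 \<Longrightarrow> q ^ m \<noteq> 1" and pos: "r > 0" "s > 0" "t > 0"
  shows "column_product q (Suc n) r s t =
    (\<Sum>(d, e, f)\<in>{0, 1} \<times> {0, 1} \<times> {0, 1}.
       column_product q n (r - d) (s - e) (t - f) * (q ^ n) ^ (d + e + f))"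
proof -
  define h where "h d z = (if d = 0 then 1 - q ^ n * q ^ 4 * z else q ^ n * (q * (q * z - 1)))"
    for d :: nat and z
  define K where "K = q_fact q n * q_fact q (n + 1) * q_fact q (n + 2) * q ^ 7 / (1 - q) ^ 3"
  define C where "C = column_factor q (n + 3) r * column_factor q (n + 3) s * column_factor q (n + 3) t"
  let ?V = "\<lambda>d e f. vandermonde3 (q ^ d * inverse q ^ r) (q ^ e * inverse q ^ s) (q ^ f * inverse q ^ t)"
  have q1: "1 - q \<noteq> 0" using nr[of 1] by auto
  have factor: "column_factor q (n + 2) (s - d) * (q ^ n) ^ d
      = h d (inverse q ^ s) / (1 - q) * column_factor q (n + 3) s"
    if "d \<in> {0, 1}" "s > 0" for d s
  proof -
    have "n + 2 + 2 = n + 4" by simp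
    then have idx: "Suc (n + 2) = n + 3" "q ^ (n + 2 + 2) = q ^ n * q ^ 4"
      by (simp_all only: power_add)
    show ?thesis
    proof (cases "d = 0")
      case True
      then show ?thesis
        using column_factor_stay[OF assms(1) nr that(2), of "n + 2"]
        unfolding idx h_def by simp
    next
      case False
      then have "d = 1" using that(1) by simp
      then show ?thesis
        using column_factor_drop[OF assms(1) nr that(2), of "n + 2"]
        unfolding idx h_def by simp
    qed
  qed
  have shift: "inverse q ^ (s - d) = q ^ d * inverse q ^ s" if "d \<in> {0, 1}" "s > 0" for d s
    using that assms(1) by (cases s) auto
  have summand: "column_product q n (r - d) (s - e) (t - f) * (q ^ n) ^ (d + e + f)
      = K * C / (1 - q) ^ 3 *
        (h d (inverse q ^ r) * h e (inverse q ^ s) * h f (inverse q ^ t) * ?V d e f)"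
    if "d \<in> {0, 1}" "e \<in> {0, 1}" "f \<in> {0, 1}" for d e f
  proof -
    have "column_product q n (r - d) (s - e) (t - f) * (q ^ n) ^ (d + e + f)
        = K * ?V d e f * ((column_factor q (n + 2) (r - d) * (q ^ n) ^ d) *
          (column_factor q (n + 2) (s - e) * (q ^ n) ^ e) *
          (column_factor q (n + 2) (t - f) * (q ^ n) ^ f))"
      unfolding column_product_def K_def shift[OF that(1) pos(1)] shift[OF that(2) pos(2)]
        shift[OF that(3) pos(3)] power_add
      by (simp only: ac_simps)
    also have "\<dots> = K * C / (1 - q) ^ 3 *
        (h d (inverse q ^ r) * h e (inverse q ^ s) * h f (inverse q ^ t) * ?V d e f)"
      unfolding factor[OF that(1) pos(1)] factor[OF that(2) pos(2)] factor[OF that(3) pos(3)] C_def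
      by (simp add: power3_eq_cube ac_simps del: power_inverse)
    finally show ?thesis .
  qed
  have "(\<Sum>(d, e, f)\<in>{0, 1} \<times> {0, 1} \<times> {0, 1}.
       column_product q n (r - d) (s - e) (t - f) * (q ^ n) ^ (d + e + f))
    = K * C / (1 - q) ^ 3 * (\<Sum>(d, e, f)\<in>{0, 1} \<times> {0, 1} \<times> {0, 1}.
        h d (inverse q ^ r) * h e (inverse q ^ s) * h f (inverse q ^ t) * ?V d e f)"
    unfolding sum_distrib_left by (rule sum.cong[OF refl], clarify, rule summand)
  also have "\<dots> = K * C / (1 - q) ^ 3 *
      ((1 - q ^ n * q) * (1 - q ^ n * q ^ 2) * (1 - q ^ n * q ^ 3) *
       vandermonde3 (inverse q ^ r) (inverse q ^ s) (inverse q ^ t))"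
    unfolding h_def vandermonde3_step ..
  also have "\<dots> = column_product q (Suc n) r s t"
  proof -
    have idx: "Suc n + 1 = Suc (Suc n)" "Suc n + 2 = Suc (Suc (Suc n))" "n + 1 = Suc n"
      "n + 2 = Suc (Suc n)" "n + 3 = Suc (Suc (Suc n))" by simp_all
    have pw: "q ^ Suc n = q ^ n * q" "q ^ Suc (Suc n) = q ^ n * q ^ 2"
      "q ^ Suc (Suc (Suc n)) = q ^ n * q ^ 3"
      by (simp_all add: eval_nat_numeral ac_simps)
    show ?thesis
      unfolding column_product_def K_def C_def idx q_fact_Suc[of q "Suc n"]
        q_fact_Suc[of q "Suc (Suc n)"] q_fact_Suc[of q n] q_int_def pw
      by (simp add: power3_eq_cube ac_simps del: power_inverse power_Suc)
  qed
  finally show ?thesis by simp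
qed

lemma column_product_0:
  fixes q :: "'a::field"
  assumes "q \<noteq> 0" and nr: "\<And>m. m > 0 \<Longrightarrow> q ^ m \<noteq> 1" and "r > s" "s > t" "t > 0"
  shows "column_product q 0 r s t = (if r = 3 then 1 else 0)"
proof (cases "r = 3")
  case True
  then have st: "s = 2" "t = 1" using assms by auto
  let ?F = "(1 - q ^ 2) / (1 - q)"
  let ?V = "vandermonde3 (inverse q ^ 3) (inverse q ^ 2) (inverse q ^ 1)"
  have q1: "1 - q \<noteq> 0" "1 - q ^ 2 \<noteq> 0" using nr[of 1] nr[of 2] by auto
  have small: "q_fact q 0 = 1" "q_fact q 1 = 1" "q_fact q 2 = ?F"
    using q1 by (simp_all add: q_fact_def q_int_def numeral_2_eq_2)
  have V: "?V * q ^ 8 = (1 - q) ^ 2 * (1 - q ^ 2)"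
    using assms(1) by (simp add: vandermonde3_def field_simps eval_nat_numeral)
  have "column_factor q 2 3 = q / ?F" "column_factor q 2 2 = 1" "column_factor q 2 1 = 1 / ?F"
    using small by (simp_all add: column_factor_def eval_nat_numeral)
  then have "column_product q 0 r s t = ?F * q ^ 7 / (1 - q) ^ 3 * ?V * (q / ?F * 1 * (1 / ?F))"
    by (simp only: column_product_def True st add_0 small mult_1_left)
  also have "\<dots> = ?V * q ^ 8 / ((1 - q) ^ 3 * ?F)"
    using q1 by (simp add: eval_nat_numeral)
  also have "\<dots> = 1"
    unfolding V using q1 by (simp add: power2_eq_square power3_eq_cube)
  finally show ?thesis using True by simp
next
  case False
  then show ?thesis using assms by (simp add: column_product_def column_factor_def)
qed

text \<open>
  The induction runs over weakly decreasing triples, since the eight steps from a strictly decreasing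
  triple reach only such triples. If the triple is not strictly decreasing and positive, then the
  product vanishes by the Vandermonde factor or by the column factor of \<open>t = 0\<close>.
\<close>

theorem column_sum_principal_specialization:
  fixes q :: "'a::field"
  assumes "q \<noteq> 0" and nr: "\<And>m. m > 0 \<Longrightarrow> q ^ m \<noteq> 1" and "r \<ge> s" "s \<ge> t"
  shows "column_sum n (\<lambda>i. q ^ (i - 1)) r s t = column_product q n r s t"
  using assms(3,4)
proof (induction n arbitrary: r s t)
  case 0
  show ?case
  proof (cases "r > s \<and> s > t \<and> t > 0")
    case True
    then show ?thesis using column_sum_0 column_product_0[OF assms(1) nr] by metis
  next
    case False
    then have "r = s \<or> s = t \<or> t = 0" using 0 by auto
    then show ?thesis using False
      by (auto simp: column_sum_def column_product_def vandermonde3_def column_factor_def)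
  qed
next
  case (Suc n)
  show ?case
  proof (cases "r > s \<and> s > t \<and> t > 0")
    case True
    then have strict: "r > s" "s > t" "t > 0" "s > 0" "r > 0" by auto
    have "column_sum (Suc n) (\<lambda>i. q ^ (i - 1)) r s t
      = (\<Sum>(d, e, f)\<in>{0, 1} \<times> {0, 1} \<times> {0, 1}.
          column_sum n (\<lambda>i. q ^ (i - 1)) (r - d) (s - e) (t - f) * (q ^ n) ^ (d + e + f))"
      by (subst column_sum_Suc[OF strict(1-3)]) simp
    also have "\<dots> = (\<Sum>(d, e, f)\<in>{0, 1} \<times> {0, 1} \<times> {0, 1}.
          column_product q n (r - d) (s - e) (t - f) * (q ^ n) ^ (d + e + f))"
    proof (rule sum.cong[OF refl], clarify)
      fix d e f :: nat
      assume "d \<in> {0, 1}" "e \<in> {0, 1}" "f \<in> {0, 1}"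
      then have "r - d \<ge> s - e" "s - e \<ge> t - f" using strict by auto
      then show "column_sum n (\<lambda>i. q ^ (i - 1)) (r - d) (s - e) (t - f) * (q ^ n) ^ (d + e + f)
          = column_product q n (r - d) (s - e) (t - f) * (q ^ n) ^ (d + e + f)"
        by (simp only: Suc.IH)
    qed
    also have "\<dots> = column_product q (Suc n) r s t"
      by (rule column_product_Suc[OF assms(1) nr strict(5,4,3), symmetric])
    finally show ?thesis .
  next
    case False
    then have "r = s \<or> s = t \<or> t = 0" using Suc.prems by auto
    then show ?thesis using False
      by (auto simp: column_sum_def column_product_def vandermonde3_def column_factor_def)
  qed
qed

section \<open>The rectangular shape\<close>

lemma choose_two_exponent: "3 * k * (k - 1) div 2 = 3 * (k choose 2)"
proof -
  have "even (k * (k - 1))" by auto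
  then obtain c where "k * (k - 1) = 2 * c" by blast
  then show ?thesis by (simp add: choose_two)
qed

text \<open>
  The powers of \<open>q\<close> in the column factors add up to \<open>3 * (k choose 2) + 3 * k + 1\<close>. The Vandermonde
  product equals \<open>q ^ (- 3 * k - 8) * (1 - q) ^ 2 * (1 - q ^ 2)\<close>, so that together with \<open>q ^ 7\<close>
  only \<open>3 * (k choose 2)\<close> is left in the exponent. The remaining factor \<open>(1 - q ^ 2) / (1 - q)\<close> is
  \<open>q_fact q 2\<close>, which comes from \<open>q_binom q (k + 2) k\<close> in the denominator.
\<close>

lemma column_product_eq_q_baxter:
  fixes q :: "'a::field"
  assumes "q \<noteq> 0" and nr: "\<And>m. m > 0 \<Longrightarrow> q ^ m \<noteq> 1" and "k \<le> n"
  shows "column_product q n (k + 3) (k + 2) (k + 1) = q_baxter q n k"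
proof -
  obtain d where n: "n = k + d" using assms(3) le_Suc_ex by blast
  have q1: "1 - q \<noteq> 0" "1 - q ^ 2 \<noteq> 0" using nr[of 1] nr[of 2] by auto
  have small: "q_fact q 1 = 1" "q_fact q 2 = (1 - q ^ 2) / (1 - q)"
    using q1 by (simp_all add: q_fact_def q_int_def numeral_2_eq_2)
  have "(k + 2 choose 2) = (k choose 2) + 2 * k + 1" "(k + 1 choose 2) = (k choose 2) + k"
    by (simp_all add: numeral_2_eq_2)
  then have "(k + 2 choose 2) + (k + 1 choose 2) + (k choose 2)
      = 3 * k * (k - 1) div 2 + 3 * k + 1"
    unfolding choose_two_exponent by simp
  then have pw: "q ^ (k + 2 choose 2) * q ^ (k + 1 choose 2) * q ^ (k choose 2)
      = q ^ (3 * k * (k - 1) div 2) * q ^ (3 * k) * q"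
    by (simp flip: power_add)
  have vand: "vandermonde3 (inverse q ^ (k + 3)) (inverse q ^ (k + 2)) (inverse q ^ (k + 1))
      * q ^ (3 * k) * q ^ 8 = (1 - q) ^ 2 * (1 - q ^ 2)"
  proof -
    let ?W = "vandermonde3 (inverse q ^ 3) (inverse q ^ 2) (inverse q ^ 1)"
    have "vandermonde3 (inverse q ^ (k + 3)) (inverse q ^ (k + 2)) (inverse q ^ (k + 1))
        = inverse q ^ (3 * k) * ?W"
      unfolding power_add mult.commute[of 3 k] power_mult vandermonde3_def
      by (simp add: algebra_simps power3_eq_cube del: power_inverse)
    then have "vandermonde3 (inverse q ^ (k + 3)) (inverse q ^ (k + 2)) (inverse q ^ (k + 1))
        * q ^ (3 * k) * q ^ 8 = (inverse q ^ (3 * k) * q ^ (3 * k)) * (?W * q ^ 8)"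
      by (simp only: ac_simps)
    also have "inverse q ^ (3 * k) * q ^ (3 * k) = 1"
      using assms(1) by (simp add: power_inverse)
    also have "?W * q ^ 8 = (1 - q) ^ 2 * (1 - q ^ 2)"
      using assms(1) by (simp add: vandermonde3_def field_simps eval_nat_numeral)
    finally show ?thesis by simp
  qed
  let ?F = "(1 - q ^ 2) / (1 - q)"
  let ?V = "vandermonde3 (inverse q ^ (k + 3)) (inverse q ^ (k + 2)) (inverse q ^ (k + 1))"
  let ?E = "q ^ (3 * k * (k - 1) div 2)"
  let ?N = "q_fact q n * q_fact q (n + 1) * q_fact q (n + 2)"
  let ?P = "q_fact q (k + 2) * q_fact q d * (q_fact q (k + 1) * q_fact q (d + 1))
    * (q_fact q k * q_fact q (d + 2))"
  note nonzero = q_fact_nonzero[OF nr]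
  have "column_factor q (n + 2) (k + 3) = q ^ (k + 2 choose 2) / (q_fact q (k + 2) * q_fact q d)"
    "column_factor q (n + 2) (k + 2) = q ^ (k + 1 choose 2) / (q_fact q (k + 1) * q_fact q (d + 1))"
    "column_factor q (n + 2) (k + 1) = q ^ (k choose 2) / (q_fact q k * q_fact q (d + 2))"
    by (simp_all add: column_factor_def n)
  then have "column_product q n (k + 3) (k + 2) (k + 1) = ?N * q ^ 7 / (1 - q) ^ 3 * ?V *
      (q ^ (k + 2 choose 2) * q ^ (k + 1 choose 2) * q ^ (k choose 2) / ?P)"
    unfolding column_product_def by (simp del: power_inverse)
  also have "\<dots> = ?N * ?E * (?V * q ^ (3 * k) * q ^ 8) / ((1 - q) ^ 3 * ?P)"
  proof -
    have "q ^ 8 = q ^ 7 * q" by (simp add: eval_nat_numeral)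
    then show ?thesis unfolding pw by (simp del: power_inverse)
  qed
  also have "\<dots> = ?N * ?E * ?F / ?P"
  proof -
    have "x * (a ^ 2 * b) / (a ^ 3 * p) = x * (b / a) / p" if "a \<noteq> 0" for x a b p :: 'a
      using that by (simp add: power2_eq_square power3_eq_cube)
    then show ?thesis unfolding vand using q1(1) by blast
  qed
  also have "\<dots> = q_baxter q n k"
  proof -
    have *: "N * N' * N'' * E * F / (A'' * D * (A' * D') * (A * D''))
        = E * ((N / (A * D) * (N' / (A * D')) * (N'' / (A * D''))) / (A' / (A * 1) * (A'' / (A * F))))"
      if "A \<noteq> 0" "A' \<noteq> 0" "A'' \<noteq> 0" "D \<noteq> 0" "D' \<noteq> 0" "D'' \<noteq> 0" "F \<noteq> 0"
      for N N' N'' E F A A' A'' D D' D'' :: 'a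
      using that by (simp add: field_simps)
    have "n - k = d" "n + 1 - k = d + 1" "n + 2 - k = d + 2" "k + 1 - k = 1" "k + 2 - k = 2"
      using n by simp_all
    moreover have "?F \<noteq> 0" using q1 by simp
    ultimately show ?thesis
      unfolding q_baxter_def q_binom_def
      by (simp only: small * nonzero not_False_eq_True)
  qed
  finally show ?thesis .
qed

lemma indet_power: "indet ^ m = Fract (monom 1 m) 1"
  by (induction m) (simp_all add: indet_def One_fract_def monom_Suc)

lemma indet_power_neq_1:
  assumes "m > 0"
  shows "indet ^ m \<noteq> 1"
proof
  assume "indet ^ m = 1"
  then have "monom 1 m = (1 :: rat poly)"
    by (simp add: indet_power One_fract_def eq_fract)
  then have "degree (monom 1 m :: rat poly) = 0" by simp
  then show False using assms by (simp add: degree_monom_eq)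
qed

theorem lemma4p2:
  fixes n k :: nat and q :: "rat poly fract"
  assumes "q = indet"
    and "k \<le> n"
  shows "q ^ (3 * k * (k - 1) div 2) *
           ((q_binom q n k * q_binom q (n + 1) k * q_binom q (n + 2) k) /
            (q_binom q (k + 1) k * q_binom q (k + 2) k))
         = schur (replicate k 3) n (\<lambda>i. q ^ (i - 1))
       \<and> q_baxter q n k = ps q n (schur (replicate k 3))"
proof -
  have q: "q \<noteq> 0" "\<And>m. m > 0 \<Longrightarrow> q ^ m \<noteq> 1"
    using indet_power_neq_1 assms(1)
    by (auto simp: indet_def eq_fract Zero_fract_def)
  have "schur (replicate k 3) n (\<lambda>i. q ^ (i - 1))
      = column_sum n (\<lambda>i. q ^ (i - 1)) (k + 3) (k + 2) (k + 1)"
    by (simp add: schur_eq_tableau_sum cells_replicate_3 column_sum_def)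
  also have "\<dots> = column_product q n (k + 3) (k + 2) (k + 1)"
    by (rule column_sum_principal_specialization[OF q]) auto
  also have "\<dots> = q_baxter q n k"
    by (rule column_product_eq_q_baxter[OF q assms(2)])
  finally show ?thesis
    by (simp add: ps_def q_baxter_def)
qed

end
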